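(* Let $R$ be the ring of $n\times n$ complex matrices and let $S\subseteq R$ be the set of positive semidefinite matrices. Let $a\in S$ and $c\in R$, let $e\in R$ be an idempotent with $eR=aR\cap cR$, and put $f=e^{*}$. Assume $a\notin eSf$, where $eSf=\{esf: s\in S\}$. Let $$C=\{s\in eSf : s\leq^{\oplus} a\},\qquad C_L=\{s\in eSf : s\leq_L a\}.$$ Let $f_a^{\dagger}$ be an $a$-weighted Moore-Penrose inverse of $f$. Then $$\max C=\max C_L=\{a f_a^{\dagger} f\}.$$
   Context: $u^{*}$ denotes the conjugate transpose of $u$. Positive semidefinite matrices are Hermitian. The direct sum partial order on $R$: $p\leq^{\oplus} q$ means $qR=pR\oplus (q-p)R$ (that is, $qR=pR+(q-p)R$ and $pR\cap (q-p)R=(0)$). The Loewner order on $S$: $p\leq_L q$ means $q-p\in S$. For $w\in S$ and $g\in R$, a $w$-weighted Moore-Penrose inverse of $g$ is a matrix $x\in R$ with $gxg=g$, $xgx=x$, $(wgx)^{*}=wgx$ and $(wxg)^{*}=wxg$. A maximal element of $C$ is an element $m\in C$, $m\neq a$, such that whenever $d\in eSf$ satisfies $m\leq^{\oplus} d\leq^{\oplus} a$, then $d=m$ or $d=a$; $\max C$ is the set of maximal elements of $C$. Likewise $\max C_L$ is the set of elements $m\in C_L$, $m\ne a$, such that whenever $d\in eSf$ satisfies $m\leq_L d\leq_L a$, then $d=m$ or $d=a$. *)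

theory Defs
  imports "HOL-Analysis.Analysis"
begin

definition conj_transpose :: "complex ^ 'n ^ 'm \<Rightarrow> complex ^ 'm ^ 'n" where
  "conj_transpose A = (\<chi> i j. cnj (A $ j $ i))"

definition hermitian :: "complex ^ 'n ^ 'n \<Rightarrow> bool" where
  "hermitian A \<longleftrightarrow> conj_transpose A = A"

text \<open>For Hermitian matrices the quadratic form is real-valued, so that only its real part
  has to be considered.\<close>

definition psd :: "(complex ^ 'n ^ 'n) set" where
  "psd = {A. hermitian A \<and> (\<forall>v. 0 \<le> Re (\<Sum>i\<in>UNIV. cnj (v $ i) * (A *v v) $ i))}"

definition right_ideal :: "complex ^ 'n ^ 'n \<Rightarrow> (complex ^ 'n ^ 'n) set" where
  "right_ideal p = {p ** x | x. x \<in> UNIV}"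

definition direct_sum_le :: "complex ^ 'n ^ 'n \<Rightarrow> complex ^ 'n ^ 'n \<Rightarrow> bool" where
  "direct_sum_le p q \<longleftrightarrow>
     right_ideal q = {u + v | u v. u \<in> right_ideal p \<and> v \<in> right_ideal (q - p)} \<and>
     right_ideal p \<inter> right_ideal (q - p) = {0}"

definition loewner_le :: "complex ^ 'n ^ 'n \<Rightarrow> complex ^ 'n ^ 'n \<Rightarrow> bool" where
  "loewner_le p q \<longleftrightarrow> q - p \<in> psd"

definition weighted_MP_inverse ::
    "complex ^ 'n ^ 'n \<Rightarrow> complex ^ 'n ^ 'n \<Rightarrow> complex ^ 'n ^ 'n \<Rightarrow> bool" where
  "weighted_MP_inverse w g x \<longleftrightarrow>
     g ** x ** g = g \<and> x ** g ** x = x \<and>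
     hermitian (w ** g ** x) \<and> hermitian (w ** x ** g)"

text \<open>The intermediate elements \<open>d\<close> range over \<open>X\<close>; the bound \<open>a\<close> itself need not belong
  to \<open>X\<close>.\<close>

definition maximal_elements ::
    "('b \<Rightarrow> 'b \<Rightarrow> bool) \<Rightarrow> 'b set \<Rightarrow> 'b \<Rightarrow> 'b set \<Rightarrow> 'b set" where
  "maximal_elements le X a C =
     {m \<in> C. m \<noteq> a \<and> (\<forall>d\<in>X. le m d \<and> le d a \<longrightarrow> d = m \<or> d = a)}"

end

theory Submission imports Defs begin

text \<open>
  Write \<open>A\<^sup>*\<close> for the conjugate transpose of \<open>A\<close>. The idea is that \<open>P = x f\<close> is the
  \<open>a\<close>-orthogonal projection attached to \<open>f\<close>: it satisfies \<open>P P = P\<close> and \<open>f P = f\<close>, and, because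
  \<open>a P\<close> is Hermitian, \<open>a P = P\<^sup>* a = P\<^sup>* a P\<close>. Put \<open>m = a x f = a P\<close>.

  Then \<open>m = P\<^sup>* a P = e (x\<^sup>* a x) f\<close> lies in \<open>e S f\<close>, and \<open>a - m = (1 - P)\<^sup>* a (1 - P)\<close> is
  positive semidefinite. Every \<open>d = e s f\<close> satisfies \<open>d P = d = P\<^sup>* d\<close>, so compressing by \<open>P\<close> fixes
  \<open>d\<close> and sends \<open>a\<close> to \<open>m\<close>: from \<open>a - d \<ge> 0\<close> it follows that \<open>m - d = P\<^sup>* (a - d) P \<ge> 0\<close>. Hence
  \<open>m\<close> is the greatest element of \<open>C\<^sub>L\<close>.

  For the direct sum order the key is that, between Hermitian matrices, \<open>p \<le>\<^sup>\<oplus> q\<close> says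
  that \<open>q y = p = p y\<close> for some \<open>y\<close> (\<open>direct_sum_le_hermitian_iff\<close>). With
  \<open>y = P\<close> this gives \<open>m \<le>\<^sup>\<oplus> a\<close>, and a witness \<open>y\<close> for \<open>d \<le>\<^sup>\<oplus> a\<close> is also one for
  \<open>d \<le>\<^sup>\<oplus> m\<close>, since \<open>m y = P\<^sup>* a y = P\<^sup>* d = d\<close>. So \<open>m\<close> is the greatest element of \<open>C\<close> as well.
  Antisymmetry of \<open>\<le>\<^sup>\<oplus>\<close> on positive semidefinite matrices is inherited from the Loewner
  order, which is coarser there (\<open>direct_sum_le_imp_loewner_le\<close>).

  As \<open>a\<close> is not in \<open>e S f\<close>, a greatest element is different from \<open>a\<close>, and it is then the only
  maximal one (\<open>maximal_elements_eq_greatest\<close>).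
\<close>

section \<open>Conjugate transposes and positive semidefinite matrices\<close>

lemma conj_transpose_conj_transpose [simp]: "conj_transpose (conj_transpose A) = A"
  by (simp add: conj_transpose_def vec_eq_iff)

lemma conj_transpose_mult: "conj_transpose (A ** B) = conj_transpose B ** conj_transpose A"
  by (simp add: conj_transpose_def matrix_matrix_mult_def vec_eq_iff mult.commute)

lemma conj_transpose_diff: "conj_transpose (A - B) = conj_transpose A - conj_transpose B"
  by (simp add: conj_transpose_def vec_eq_iff)

lemma conj_transpose_one: "conj_transpose (mat 1) = mat 1"
  by (auto simp: conj_transpose_def mat_def vec_eq_iff)

lemma matrix_diff_ldistrib: "A ** (B - C) = A ** B - A ** C"
  for A :: "complex ^ 'n ^ 'm" and B C :: "complex ^ 'k ^ 'n"
  by (simp add: matrix_matrix_mult_def vec_eq_iff algebra_simps sum_subtractf)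

lemma matrix_diff_rdistrib: "(B - C) ** A = B ** A - C ** A"
  for A :: "complex ^ 'k ^ 'n" and B C :: "complex ^ 'n ^ 'm"
  by (simp add: matrix_matrix_mult_def vec_eq_iff algebra_simps sum_subtractf)

lemma matrix_mult_zero: "A ** 0 = 0" "0 ** A = 0" for A :: "complex ^ 'n ^ 'm"
  by (simp_all add: matrix_matrix_mult_def vec_eq_iff)

lemma inner_matrix_vector_adjoint: "u \<bullet> (A *v w) = (conj_transpose A *v u) \<bullet> w"
proof -
  have "u \<bullet> (A *v w) = (\<Sum>i\<in>UNIV. \<Sum>j\<in>UNIV. u $ i \<bullet> (A $ i $ j * w $ j))"
    by (simp add: inner_vec_def matrix_vector_mult_def inner_sum_right)
  also have "\<dots> = (\<Sum>i\<in>UNIV. \<Sum>j\<in>UNIV. (cnj (A $ i $ j) * u $ i) \<bullet> w $ j)"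
    by (intro sum.cong refl) (simp add: inner_complex_def algebra_simps)
  also have "\<dots> = (conj_transpose A *v u) \<bullet> w"
    by (subst sum.swap)
      (simp add: inner_vec_def matrix_vector_mult_def conj_transpose_def inner_sum_left)
  finally show ?thesis .
qed

text \<open>The real part of the complex sesquilinear form is the real inner product of
  \<open>\<complex>\<^sup>n\<close> as a Euclidean space, whose theory thereby becomes applicable.\<close>

lemma psd_iff_inner: "A \<in> psd \<longleftrightarrow> hermitian A \<and> (\<forall>v. 0 \<le> v \<bullet> (A *v v))"
  by (simp add: psd_def inner_vec_def inner_complex_def)

lemma psd_hermitian: "A \<in> psd \<Longrightarrow> conj_transpose A = A"
  by (simp add: psd_def hermitian_def)

lemma psd_congruence:
  assumes "A \<in> psd"
  shows "conj_transpose B ** A ** B \<in> psd"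
proof -
  have "v \<bullet> ((conj_transpose B ** A ** B) *v v) = (B *v v) \<bullet> (A *v (B *v v))" for v
    by (simp add: matrix_vector_mul_assoc [symmetric] inner_matrix_vector_adjoint [of v "conj_transpose B"])
  then show ?thesis
    using assms by (simp add: psd_iff_inner hermitian_def conj_transpose_mult matrix_mul_assoc)
qed

text \<open>Polarisation: the form of \<open>D = A - B\<close> vanishes identically, and its value at
  \<open>v + D v\<close> exceeds those at \<open>v\<close> and \<open>D v\<close> by \<open>2 \<parallel>D v\<parallel>\<^sup>2\<close>.\<close>

lemma loewner_le_antisym:
  assumes "loewner_le A B" "loewner_le B A"
  shows "A = B"
proof -
  define D where "D = A - B"
  have D: "D \<in> psd" "- D \<in> psd"
    using assms by (simp_all add: loewner_le_def D_def)
  have zero: "v \<bullet> (D *v v) = 0" for v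
  proof -
    have "(- D) *v v = - (D *v v)"
      by (simp add: matrix_vector_mult_def vec_eq_iff sum_negf)
    then show ?thesis
      using D unfolding psd_iff_inner
      by (metis inner_minus_right neg_0_le_iff_le order_antisym)
  qed
  have "D *v v = 0" for v
  proof -
    have "v \<bullet> (D *v (D *v v)) = (D *v v) \<bullet> (D *v v)"
      using inner_matrix_vector_adjoint [of v D "D *v v"] psd_hermitian [OF D(1)] by simp
    then have "2 * ((D *v v) \<bullet> (D *v v)) = 0"
      using zero [of "v + D *v v"] zero [of v] zero [of "D *v v"]
      by (simp add: matrix_vector_right_distrib inner_add_left inner_add_right)
    then show ?thesis by simp
  qed
  then have "D = 0"
    by (simp add: matrix_eq)
  then show ?thesis by (simp add: D_def)
qed

text \<open>If \<open>a y\<close> is fixed by \<open>y\<close> on the right and Hermitian, then \<open>a y = y\<^sup>* a = y\<^sup>* a y\<close>, so that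
  the two congruences by \<open>y\<close> and \<open>1 - y\<close> split \<open>a\<close> into the positive parts \<open>a y\<close> and
  \<open>a - a y\<close>.\<close>

lemma loewner_le_of_hermitian_factor:
  assumes a: "a \<in> psd" and d: "conj_transpose d = d" and ay: "a ** y = d" and dy: "d ** y = d"
  shows "loewner_le d a"
proof -
  let ?y = "conj_transpose y"
  have ya: "?y ** a = d"
    using conj_transpose_mult [of a y] by (simp add: ay d psd_hermitian [OF a])
  have "conj_transpose (mat 1 - y) ** a ** (mat 1 - y) = a - d"
    by (simp add: conj_transpose_diff conj_transpose_one matrix_diff_ldistrib
        matrix_diff_rdistrib ya ay dy)
  then show ?thesis
    unfolding loewner_le_def using psd_congruence [OF a, of "mat 1 - y"] by simp
qed

section \<open>The direct sum order\<close>

text \<open>Forwards: \<open>p\<close> lies in the right ideal of \<open>q\<close>, say \<open>p = q y\<close>; then \<open>p - p y = (q - p) y\<close> lies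
  in both summands and so vanishes. Backwards: taking adjoints, \<open>y\<^sup>*\<close> fixes \<open>p\<close> and kills
  \<open>q - p\<close> on the left, which separates the two right ideals.\<close>

lemma direct_sum_le_hermitian_iff:
  fixes p q :: "complex ^ 'n ^ 'n"
  assumes p: "conj_transpose p = p" and q: "conj_transpose q = q"
  shows "direct_sum_le p q \<longleftrightarrow> (\<exists>y. q ** y = p \<and> p ** y = p)"
proof
  assume le: "direct_sum_le p q"
  have "p = p ** mat 1 + (q - p) ** 0"
    by (simp add: matrix_mult_zero)
  then have "p \<in> right_ideal q"
    using le unfolding direct_sum_le_def right_ideal_def by blast
  then obtain y where y: "p = q ** y"
    unfolding right_ideal_def by blast
  have "p ** (mat 1 - y) = (q - p) ** y"
    by (simp add: matrix_diff_ldistrib matrix_diff_rdistrib y [symmetric])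
  then have "p ** (mat 1 - y) \<in> right_ideal p \<inter> right_ideal (q - p)"
    unfolding right_ideal_def by blast
  then have "p ** (mat 1 - y) = 0"
    using le unfolding direct_sum_le_def by blast
  then show "\<exists>y. q ** y = p \<and> p ** y = p"
    using y by (auto simp: matrix_diff_ldistrib)
next
  assume "\<exists>y. q ** y = p \<and> p ** y = p"
  then obtain y where qy: "q ** y = p" and py: "p ** y = p" by blast
  let ?y = "conj_transpose y"
  have yq: "?y ** q = p" and yp: "?y ** p = p"
    using conj_transpose_mult [of q y] conj_transpose_mult [of p y] unfolding qy py p q by simp_all
  have "\<exists>u v. q ** w = p ** u + (q - p) ** v" for w :: "complex ^ 'n ^ 'n"
    by (rule exI [of _ w], rule exI [of _ w]) (simp add: matrix_diff_rdistrib)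
  moreover have "\<exists>w. p ** u + (q - p) ** v = q ** w" for u v :: "complex ^ 'n ^ 'n"
    by (rule exI [of _ "y ** u + (v - y ** v)"])
      (simp add: matrix_diff_ldistrib matrix_diff_rdistrib matrix_add_ldistrib matrix_mul_assoc qy)
  ultimately have "right_ideal q = {u + v | u v. u \<in> right_ideal p \<and> v \<in> right_ideal (q - p)}"
    unfolding right_ideal_def by blast
  moreover have "p ** u = 0" if "p ** u = (q - p) ** v" for u v :: "complex ^ 'n ^ 'n"
  proof -
    have "p ** u = ?y ** (p ** u)"
      by (simp add: matrix_mul_assoc yp)
    also have "\<dots> = (?y ** (q - p)) ** v"
      by (simp add: that matrix_mul_assoc)
    also have "\<dots> = 0"
      by (simp add: matrix_diff_ldistrib yq yp matrix_mult_zero)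
    finally show ?thesis .
  qed
  moreover have "0 \<in> right_ideal r" for r :: "complex ^ 'n ^ 'n"
    by (auto simp: right_ideal_def matrix_mult_zero intro!: exI [of _ 0])
  ultimately show "direct_sum_le p q"
    unfolding direct_sum_le_def right_ideal_def by auto
qed

lemma direct_sum_le_imp_loewner_le:
  assumes "p \<in> psd" "q \<in> psd" "direct_sum_le p q"
  shows "loewner_le p q"
proof -
  obtain y where "q ** y = p" "p ** y = p"
    using assms direct_sum_le_hermitian_iff [of p q] psd_hermitian by blast
  with assms(1,2) psd_hermitian show ?thesis
    by (intro loewner_le_of_hermitian_factor) auto
qed

section \<open>Greatest elements below the weight\<close>

lemma maximal_elements_eq_greatest:
  assumes "m \<in> X" "le m a" "a \<notin> X"
    and greatest: "\<And>d. d \<in> X \<Longrightarrow> le d a \<Longrightarrow> le d m"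
    and antisym: "\<And>d. d \<in> X \<Longrightarrow> le m d \<Longrightarrow> le d m \<Longrightarrow> d = m"
  shows "maximal_elements le X a {s \<in> X. le s a} = {m}"
  using assms unfolding maximal_elements_def by blast

theorem theorem17:
  fixes a c e f x :: "complex ^ 'n ^ 'n"
    and eSf C C\<^sub>L :: "(complex ^ 'n ^ 'n) set"
  assumes "a \<in> psd"
    and "e ** e = e"
    and "right_ideal e = right_ideal a \<inter> right_ideal c"
    and "f = conj_transpose e"
    and "eSf = {e ** s ** f | s. s \<in> psd}"
    and "a \<notin> eSf"
    and "C = {s \<in> eSf. direct_sum_le s a}"
    and "C\<^sub>L = {s \<in> eSf. loewner_le s a}"
    and "weighted_MP_inverse a f x"
  shows "maximal_elements direct_sum_le eSf a C = {a ** x ** f}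
       \<and> maximal_elements loewner_le eSf a C\<^sub>L = {a ** x ** f}"
proof -
  have a: "conj_transpose a = a"
    using assms(1) by (rule psd_hermitian)
  have fxf: "f ** x ** f = f" and m: "conj_transpose (a ** x ** f) = a ** x ** f"
    using assms(9) by (simp_all add: weighted_MP_inverse_def hermitian_def)
  have e: "e = conj_transpose f"
    using assms(4) by simp
  define P where "P = x ** f"
  define m where "m = a ** x ** f"
  let ?P = "conj_transpose P"
  have aP: "a ** P = m"
    by (simp add: P_def m_def matrix_mul_assoc)
  have fP: "f ** P = f"
    using fxf by (simp add: P_def matrix_mul_assoc)
  have m_herm: "conj_transpose m = m"
    using m by (simp add: m_def)
  have Pa: "?P ** a = m"
    using conj_transpose_mult [of a P] by (simp add: aP m_herm a)
  have mP: "m ** P = m"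
    using fP by (simp add: m_def matrix_mul_assoc [symmetric])

  have "m = ?P ** a ** P"
    by (simp add: Pa mP)
  also have "\<dots> = e ** (conj_transpose x ** a ** x) ** f"
    by (simp add: P_def e conj_transpose_mult matrix_mul_assoc)
  finally have m_mem: "m \<in> eSf"
    using psd_congruence [OF assms(1)] assms(5) by blast

  have eSf_psd: "d \<in> psd" if "d \<in> eSf" for d
    using that psd_congruence [of _ f] e assms(5) by auto
  have dP: "d ** P = d" if "d \<in> eSf" for d
    using that fP assms(5) by (auto simp: matrix_mul_assoc [symmetric])
  have Pd: "?P ** d = d" if "d \<in> eSf" for d
    using conj_transpose_mult [of d P]
    unfolding dP [OF that] psd_hermitian [OF eSf_psd [OF that]] by simp

  have "maximal_elements loewner_le eSf a C\<^sub>L = {m}"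
    unfolding assms(8)
  proof (rule maximal_elements_eq_greatest)
    show "loewner_le m a"
      using assms(1) m_herm aP mP by (rule loewner_le_of_hermitian_factor)
    fix d assume d: "d \<in> eSf" "loewner_le d a"
    have "?P ** (a - d) ** P = m - d"
      by (simp add: matrix_diff_ldistrib matrix_diff_rdistrib Pa mP Pd d dP)
    then show "loewner_le d m"
      using d(2) psd_congruence [of "a - d" P] by (simp add: loewner_le_def)
  qed (use m_mem assms(6) loewner_le_antisym in auto)

  moreover have "maximal_elements direct_sum_le eSf a C = {m}"
    unfolding assms(7)
  proof (rule maximal_elements_eq_greatest)
    show "direct_sum_le m a"
      using aP mP direct_sum_le_hermitian_iff [OF m_herm a] by blast
  next
    fix d assume d: "d \<in> eSf" "direct_sum_le d a"
    have d_herm: "conj_transpose d = d"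
      using eSf_psd d(1) psd_hermitian by blast
    obtain y where ay: "a ** y = d" and dy: "d ** y = d"
      using d(2) direct_sum_le_hermitian_iff [OF d_herm a] by blast
    have "m ** y = d"
      using Pd [OF d(1)] by (simp add: Pa [symmetric] matrix_mul_assoc [symmetric] ay)
    then show "direct_sum_le d m"
      using dy direct_sum_le_hermitian_iff [OF d_herm m_herm] by blast
  next
    fix d assume "d \<in> eSf" "direct_sum_le m d" "direct_sum_le d m"
    then show "d = m"
      using eSf_psd m_mem direct_sum_le_imp_loewner_le loewner_le_antisym by blast
  qed (use m_mem assms(6) in auto)

  ultimately show ?thesis
    by (simp add: m_def)
qed

end
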